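(* Let $P_n$ be the path with vertex set $\{0,1,\dots,n-1\}$ and edges $\{i-1,i\}$ for $i=1,\dots,n-1$. Consider one cop chasing a drunk robber on $P_n$, where the cop starts at vertex $0$ and in each round moves from vertex $i$ to vertex $i+1$ (until capture, or until reaching $n-1$). Let $T_n$ be the capture time. Then \[\frac{n}{2}\left(1-O\left(\frac{\log n}{n}\right)\right)\leq \mathbb{E}T_n\leq \frac{n-1}{2},\] where the $O(\cdot)$ refers to $n\to\infty$.
   Context: Drunk robber game: the cop first chooses its initial vertex; then the robber's initial vertex $Y_0$ is chosen uniformly at random from the vertex set. In each round $t=1,2,\dots$ the cop moves first, then the robber moves from his current vertex $v$ to a neighbour of $v$ chosen uniformly at random (he never stays put), independently of the cop's position. The capture time is $T_n=\min\{t: X_t=Y_t\}$, where $X_t$, $Y_t$ are the cop's and robber's positions at time $t$ (capture may occur after the cop's move or after the robber's move). *)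

theory Defs
  imports "HOL-Probability.Probability" "HOL-Library.Landau_Symbols"
begin

definition path_vertices :: "nat \<Rightarrow> nat set" where
  "path_vertices n = {0..<n}"

definition path_edges :: "nat \<Rightarrow> nat set set" where
  "path_edges n = {{i - 1, i} | i. 1 \<le> i \<and> i \<le> n - 1}"

definition neighbours :: "'v set set \<Rightarrow> 'v \<Rightarrow> 'v set" where
  "neighbours E v = {w. {v, w} \<in> E}"

(* Y t is the robber's position after round t, and Y 0 his initial position. The step law is
   conditional on the whole history of the walk. At a vertex without neighbours it imposes
   nothing; for the path this concerns only n = 1, where Y is constant anyway. *)
locale drunk_robber = prob_space M
  for M :: "'a measure" and V :: "'v set" and E :: "'v set set" and Y :: "nat \<Rightarrow> 'a \<Rightarrow> 'v" +
  assumes random_position: "\<And>t. Y t \<in> measurable M (count_space V)"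
    and uniform_start: "\<And>v. v \<in> V \<Longrightarrow> \<P>(\<omega> in M. Y 0 \<omega> = v) = 1 / real (card V)"
    and uniform_step: "\<And>t h w. \<P>(\<omega> in M. \<forall>i\<le>t. Y i \<omega> = h i) > 0 \<Longrightarrow> w \<in> neighbours E (h t) \<Longrightarrow>
      \<P>(\<omega> in M. Y (Suc t) \<omega> = w \<bar> \<forall>i\<le>t. Y i \<omega> = h i) = 1 / real (card (neighbours E (h t)))"

(* In round t = Suc s the cop first moves to x t while the robber is still at y s; then the robber
   moves to y t. Capture in round 0 means that the initial positions coincide. *)
definition captured_in_round :: "(nat \<Rightarrow> 'v) \<Rightarrow> (nat \<Rightarrow> 'v) \<Rightarrow> nat \<Rightarrow> bool" where
  "captured_in_round x y t \<longleftrightarrow> x t = y t \<or> (\<exists>s. t = Suc s \<and> x t = y s)"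

(* The infimum of the empty set is infinity: no capture. *)
definition capture_time :: "(nat \<Rightarrow> 'v) \<Rightarrow> (nat \<Rightarrow> 'v) \<Rightarrow> enat" where
  "capture_time x y = Inf (enat ` {t. captured_in_round x y t})"

(* Stopping the cop at the capture would not affect the capture time. *)
definition sweeping_cop :: "nat \<Rightarrow> nat \<Rightarrow> nat" where
  "sweeping_cop n t = min t (n - 1)"

definition expected_capture_time ::
    "'a measure \<Rightarrow> (nat \<Rightarrow> 'v) \<Rightarrow> (nat \<Rightarrow> 'a \<Rightarrow> 'v) \<Rightarrow> ennreal" where
  "expected_capture_time M x Y =
     (\<integral>\<^sup>+\<omega>. ennreal_of_enat (capture_time x (\<lambda>t. Y t \<omega>)) \<partial>M)"

end

(* While the robber is free, the gap between him and the cop is positive. In mean, a round shrinks it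
   by one, plus one more whenever the robber has to step back from the end n - 1, and at capture it
   is zero. Since the initial gap has mean (n - 1) / 2, the expected capture time is (n - 1) / 2
   minus the expected number of steps back. The uniform start is dominated by 1 / (n - 1) times the
   invariant measure deg, so the robber is at n - 1 at any given time with probability at most
   1 / (n - 1), and fewer than n rounds are played: the number of steps back has mean at most 1.
   Hence the error term g n = 3 / n, which is even smaller than ln n / n. *)
theory Submission
  imports Defs "HOL-Real_Asymp.Real_Asymp"
begin

section \<open>Events depending on the walk up to a given time\<close>

text \<open>Stands in for measurability in the natural filtration of the walk, as a property of
  predicates on trajectories.\<close>

definition determined_by_past :: "nat \<Rightarrow> ((nat \<Rightarrow> 'v) \<Rightarrow> bool) \<Rightarrow> bool" where
  "determined_by_past t P \<longleftrightarrow> (\<forall>h h'. (\<forall>i\<le>t. h i = h' i) \<longrightarrow> P h = P h')"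

lemma determined_by_pastD:
  "determined_by_past t P \<Longrightarrow> (\<And>i. i \<le> t \<Longrightarrow> h i = h' i) \<Longrightarrow> P h \<longleftrightarrow> P h'"
  unfolding determined_by_past_def by blast

lemma determined_by_past_conj:
  "determined_by_past t P \<Longrightarrow> determined_by_past t Q \<Longrightarrow> determined_by_past t (\<lambda>h. P h \<and> Q h)"
  unfolding determined_by_past_def by metis

lemma determined_by_past_coordinate: "i \<le> t \<Longrightarrow> determined_by_past t (\<lambda>h. Q (h i))"
  unfolding determined_by_past_def by metis

section \<open>Markov property of the walk on a finite graph\<close>

locale finite_drunk_robber = drunk_robber M V E Y
  for M :: "'a measure" and V :: "'v set" and E :: "'v set set" and Y :: "nat \<Rightarrow> 'a \<Rightarrow> 'v" +
  assumes finite_V: "finite V"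
    and neighbours_subset: "v \<in> V \<Longrightarrow> neighbours E v \<subseteq> V"
    and neighbours_nonempty: "v \<in> V \<Longrightarrow> neighbours E v \<noteq> {}"
begin

lemma Y_in_V: "\<omega> \<in> space M \<Longrightarrow> Y t \<omega> \<in> V"
  using measurable_space[OF random_position] by simp

lemma finite_neighbours: "v \<in> V \<Longrightarrow> finite (neighbours E v)"
  using finite_V neighbours_subset finite_subset by blast

lemma card_neighbours_pos: "v \<in> V \<Longrightarrow> card (neighbours E v) > 0"
  using finite_neighbours neighbours_nonempty by (simp add: card_gt_0_iff)

lemma position_event: "{\<omega> \<in> space M. Y t \<omega> = v} \<in> events"
proof (cases "v \<in> V")
  case True
  then have "Y t -` {v} \<inter> space M \<in> events"
    by (intro measurable_sets[OF random_position]) auto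
  also have "Y t -` {v} \<inter> space M = {\<omega> \<in> space M. Y t \<omega> = v}" by auto
  finally show ?thesis .
next
  case False
  then have "{\<omega> \<in> space M. Y t \<omega> = v} = {}" using Y_in_V by auto
  then show ?thesis by (simp only: sets.empty_sets)
qed

lemma history_eq_event: "{\<omega> \<in> space M. \<forall>i\<le>(t::nat). Y i \<omega> = h i} \<in> events"
  by (intro sets.sets_Collect_countable_All sets.sets_Collect position_event)

text \<open>As \<open>V\<close> is finite, there are only finitely many histories up to
  \<open>t\<close>, so the event is a finite union of cylinders.\<close>

lemma history_event:
  assumes "determined_by_past t P"
  shows "{\<omega> \<in> space M. P (\<lambda>i. Y i \<omega>)} \<in> events"
proof -
  let ?H = "{h \<in> PiE {..t} (\<lambda>_. V). P h}"
  have "{\<omega> \<in> space M. P (\<lambda>i. Y i \<omega>)} = (\<Union>h\<in>?H. {\<omega> \<in> space M. \<forall>i\<le>t. Y i \<omega> = h i})"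
  proof (intro equalityI subsetI)
    fix \<omega> assume \<omega>: "\<omega> \<in> {\<omega> \<in> space M. P (\<lambda>i. Y i \<omega>)}"
    let ?h = "\<lambda>i\<in>{..t}. Y i \<omega>"
    have "P ?h \<longleftrightarrow> P (\<lambda>i. Y i \<omega>)" by (rule determined_by_pastD[OF assms]) simp
    then have "?h \<in> ?H" using \<omega> Y_in_V by auto
    then show "\<omega> \<in> (\<Union>h\<in>?H. {\<omega> \<in> space M. \<forall>i\<le>t. Y i \<omega> = h i})"
      using \<omega> by (intro UN_I[of ?h]) auto
  next
    fix \<omega> assume "\<omega> \<in> (\<Union>h\<in>?H. {\<omega> \<in> space M. \<forall>i\<le>t. Y i \<omega> = h i})"
    then obtain h where "h \<in> ?H" "\<omega> \<in> space M" "\<forall>i\<le>t. Y i \<omega> = h i" by auto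
    moreover from this have "P (\<lambda>i. Y i \<omega>) \<longleftrightarrow> P h" by (intro determined_by_pastD[OF assms]) simp
    ultimately show "\<omega> \<in> {\<omega> \<in> space M. P (\<lambda>i. Y i \<omega>)}" by simp
  qed
  moreover have "finite ?H" using finite_V by (simp add: finite_PiE)
  ultimately show ?thesis by (auto intro!: sets.finite_UN history_eq_event)
qed

text \<open>The cylinders of the histories partition the event. Histories are taken from
  \<open>PiE\<close>, which fixes their values after \<open>t\<close>, so each outcome lies in
  exactly one cylinder.\<close>

lemma prob_history_sum:
  assumes dep: "determined_by_past t P"
    and Q: "{\<omega> \<in> space M. Q \<omega>} \<in> events"
  shows "\<P>(\<omega> in M. P (\<lambda>i. Y i \<omega>) \<and> Q \<omega>) =
    (\<Sum>h \<in> {h \<in> PiE {..t} (\<lambda>_. V). P h}. \<P>(\<omega> in M. (\<forall>i\<le>t. Y i \<omega> = h i) \<and> Q \<omega>))"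
proof (rule prob_sum)
  show "finite {h \<in> PiE {..t} (\<lambda>_. V). P h}" using finite_V by (simp add: finite_PiE)
  show "{\<omega> \<in> space M. P (\<lambda>i. Y i \<omega>) \<and> Q \<omega>} \<in> events"
    by (intro sets.sets_Collect_conj history_event[OF dep] Q)
  show "{\<omega> \<in> space M. (\<forall>i\<le>t. Y i \<omega> = h i) \<and> Q \<omega>} \<in> events" for h
    by (intro sets.sets_Collect_conj history_eq_event Q)
  show "AE \<omega> in M. (\<forall>h\<in>{h \<in> PiE {..t} (\<lambda>_. V). P h}.
      (\<forall>i\<le>t. Y i \<omega> = h i) \<and> Q \<omega> \<longrightarrow> P (\<lambda>i. Y i \<omega>) \<and> Q \<omega>) \<and>
    (P (\<lambda>i. Y i \<omega>) \<and> Q \<omega> \<longrightarrow>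
      (\<exists>!h\<in>{h \<in> PiE {..t} (\<lambda>_. V). P h}. (\<forall>i\<le>t. Y i \<omega> = h i) \<and> Q \<omega>))"
  proof (rule AE_I2, intro conjI ballI impI)
    fix \<omega> h
    assume "h \<in> {h \<in> PiE {..t} (\<lambda>_. V). P h}" "(\<forall>i\<le>t. Y i \<omega> = h i) \<and> Q \<omega>"
    moreover from this have "P (\<lambda>i. Y i \<omega>) \<longleftrightarrow> P h" by (intro determined_by_pastD[OF dep]) simp
    ultimately show "P (\<lambda>i. Y i \<omega>)" "Q \<omega>" by auto
  next
    fix \<omega> assume \<omega>: "\<omega> \<in> space M" "P (\<lambda>i. Y i \<omega>) \<and> Q \<omega>"
    let ?h = "\<lambda>i\<in>{..t}. Y i \<omega>"
    have "P ?h \<longleftrightarrow> P (\<lambda>i. Y i \<omega>)" by (rule determined_by_pastD[OF dep]) simp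
    then show "\<exists>!h. h \<in> {h \<in> PiE {..t} (\<lambda>_. V). P h} \<and> (\<forall>i\<le>t. Y i \<omega> = h i) \<and> Q \<omega>"
      using \<omega> Y_in_V
      by (intro ex1I[of _ ?h]) (auto intro!: extensionalityI[of _ "{..t}"] simp: PiE_def)
  qed
qed

text \<open>\<open>uniform_step\<close> conditions on a complete history. All histories ending at
  \<open>v\<close> give the same factor, so it can be pulled out of the sum over those compatible
  with \<open>P\<close>. The product form also covers null events.\<close>

lemma markov_step:
  assumes dep: "determined_by_past t P"
    and w: "w \<in> neighbours E v"
  shows "\<P>(\<omega> in M. P (\<lambda>i. Y i \<omega>) \<and> Y t \<omega> = v \<and> Y (Suc t) \<omega> = w) =
    \<P>(\<omega> in M. P (\<lambda>i. Y i \<omega>) \<and> Y t \<omega> = v) / real (card (neighbours E v))"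
proof -
  let ?P = "\<lambda>h. P h \<and> h t = v"
  let ?H = "{h \<in> PiE {..t} (\<lambda>_. V). ?P h}"
  have dep': "determined_by_past t ?P"
    using dep determined_by_past_coordinate[of t t "\<lambda>x. x = v"] by (rule determined_by_past_conj) simp
  have hist: "\<P>(\<omega> in M. (\<forall>i\<le>t. Y i \<omega> = h i) \<and> Y (Suc t) \<omega> = w) =
      \<P>(\<omega> in M. (\<forall>i\<le>t. Y i \<omega> = h i) \<and> True) / real (card (neighbours E v))" if "h \<in> ?H" for h
  proof (cases "\<P>(\<omega> in M. \<forall>i\<le>t. Y i \<omega> = h i) = 0")
    \<comment> \<open>The step law is silent about null histories, but then both sides vanish by
      monotonicity.\<close>
    case True
    have "\<P>(\<omega> in M. (\<forall>i\<le>t. Y i \<omega> = h i) \<and> Y (Suc t) \<omega> = w) \<le> \<P>(\<omega> in M. \<forall>i\<le>t. Y i \<omega> = h i)"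
      by (intro finite_measure_mono history_eq_event) auto
    with True show ?thesis by (simp add: measure_le_0_iff)
  next
    case False
    then have pos: "\<P>(\<omega> in M. \<forall>i\<le>t. Y i \<omega> = h i) > 0" by (simp add: zero_less_measure_iff)
    from uniform_step[OF pos, of w] that w
    have "\<P>(\<omega> in M. Y (Suc t) \<omega> = w \<bar> \<forall>i\<le>t. Y i \<omega> = h i) = 1 / real (card (neighbours E v))"
      by simp
    with pos show ?thesis by (simp add: cond_prob_def field_simps conj_commute)
  qed
  have "\<P>(\<omega> in M. ?P (\<lambda>i. Y i \<omega>) \<and> Y (Suc t) \<omega> = w) =
      (\<Sum>h\<in>?H. \<P>(\<omega> in M. (\<forall>i\<le>t. Y i \<omega> = h i) \<and> Y (Suc t) \<omega> = w))"
    by (rule prob_history_sum[OF dep' position_event])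
  also have "\<dots> = (\<Sum>h\<in>?H. \<P>(\<omega> in M. (\<forall>i\<le>t. Y i \<omega> = h i) \<and> True)) /
      real (card (neighbours E v))"
    unfolding sum_divide_distrib by (intro sum.cong refl hist)
  also have "(\<Sum>h\<in>?H. \<P>(\<omega> in M. (\<forall>i\<le>t. Y i \<omega> = h i) \<and> True)) =
      \<P>(\<omega> in M. ?P (\<lambda>i. Y i \<omega>) \<and> True)"
    by (rule prob_history_sum[where Q = "\<lambda>_. True", OF dep', symmetric]) auto
  finally show ?thesis by (simp add: conj_assoc)
qed

text \<open>The neighbours of \<open>v\<close> receive \<open>deg v\<close> shares of
  \<open>1 / deg v\<close>, hence all the mass at \<open>v\<close>; the remaining nonnegative terms
  must be zero.\<close>

lemma markov_nonneighbour:
  assumes dep: "determined_by_past t P"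
    and v: "v \<in> V" and w: "w \<notin> neighbours E v"
  shows "\<P>(\<omega> in M. P (\<lambda>i. Y i \<omega>) \<and> Y t \<omega> = v \<and> Y (Suc t) \<omega> = w) = 0"
proof (cases "w \<in> V")
  case False
  then have "{\<omega> \<in> space M. P (\<lambda>i. Y i \<omega>) \<and> Y t \<omega> = v \<and> Y (Suc t) \<omega> = w} = {}"
    using Y_in_V by auto
  then show ?thesis by (simp only: measure_empty)
next
  case True
  let ?p = "\<lambda>w. \<P>(\<omega> in M. P (\<lambda>i. Y i \<omega>) \<and> Y t \<omega> = v \<and> Y (Suc t) \<omega> = w)"
  have ev: "{\<omega> \<in> space M. P (\<lambda>i. Y i \<omega>)} \<in> events"
    using dep by (rule history_event)
  have total: "\<P>(\<omega> in M. P (\<lambda>i. Y i \<omega>) \<and> Y t \<omega> = v) = (\<Sum>w\<in>V. ?p w)"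
    by (rule prob_sum) (use finite_V Y_in_V in
      \<open>auto intro!: sets.sets_Collect_conj ev position_event\<close>)
  have "(\<Sum>w\<in>neighbours E v. ?p w) = \<P>(\<omega> in M. P (\<lambda>i. Y i \<omega>) \<and> Y t \<omega> = v)"
    using card_neighbours_pos[OF v] by (simp add: markov_step[OF dep])
  with total have "(\<Sum>w\<in>V. ?p w) - (\<Sum>w\<in>neighbours E v. ?p w) = 0" by simp
  then have "(\<Sum>w\<in>V - neighbours E v. ?p w) = 0"
    using finite_V neighbours_subset[OF v] by (simp add: sum_diff)
  then show ?thesis
    using True w finite_V by (subst (asm) sum_nonneg_eq_0_iff) auto
qed

lemma prob_step:
  assumes dep: "determined_by_past t P"
  shows "\<P>(\<omega> in M. P (\<lambda>i. Y i \<omega>) \<and> Y (Suc t) \<omega> = w) =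
    (\<Sum>v\<in>V. if w \<in> neighbours E v
      then \<P>(\<omega> in M. P (\<lambda>i. Y i \<omega>) \<and> Y t \<omega> = v) / real (card (neighbours E v)) else 0)"
proof -
  have ev: "{\<omega> \<in> space M. P (\<lambda>i. Y i \<omega>)} \<in> events"
    using dep by (rule history_event)
  have "\<P>(\<omega> in M. P (\<lambda>i. Y i \<omega>) \<and> Y (Suc t) \<omega> = w) =
      (\<Sum>v\<in>V. \<P>(\<omega> in M. P (\<lambda>i. Y i \<omega>) \<and> Y t \<omega> = v \<and> Y (Suc t) \<omega> = w))"
    by (rule prob_sum) (use finite_V Y_in_V in
      \<open>auto intro!: sets.sets_Collect_conj ev position_event\<close>)
  also have "\<dots> = (\<Sum>v\<in>V. if w \<in> neighbours E v
      then \<P>(\<omega> in M. P (\<lambda>i. Y i \<omega>) \<and> Y t \<omega> = v) / real (card (neighbours E v)) else 0)"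
    by (intro sum.cong refl) (simp add: markov_step[OF dep] markov_nonneighbour[OF dep])
  finally show ?thesis .
qed

text \<open>Exchanging the sums in \<open>prob_step\<close> moves the transition from the
  distribution to the function \<open>f\<close>, so a drift can be computed vertex by
  vertex.\<close>

lemma expectation_step:
  fixes f :: "'v \<Rightarrow> real"
  assumes dep: "determined_by_past t P"
  shows "(\<Sum>w\<in>V. \<P>(\<omega> in M. P (\<lambda>i. Y i \<omega>) \<and> Y (Suc t) \<omega> = w) * f w) =
    (\<Sum>v\<in>V. \<P>(\<omega> in M. P (\<lambda>i. Y i \<omega>) \<and> Y t \<omega> = v) *
      ((\<Sum>w\<in>neighbours E v. f w) / real (card (neighbours E v))))"
proof -
  let ?q = "\<lambda>v. \<P>(\<omega> in M. P (\<lambda>i. Y i \<omega>) \<and> Y t \<omega> = v)"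
  let ?N = "neighbours E"
  have "(\<Sum>w\<in>V. \<P>(\<omega> in M. P (\<lambda>i. Y i \<omega>) \<and> Y (Suc t) \<omega> = w) * f w) =
      (\<Sum>w\<in>V. \<Sum>v\<in>V. if w \<in> ?N v then ?q v / real (card (?N v)) * f w else 0)"
    unfolding prob_step[OF dep] sum_distrib_right by (intro sum.cong refl) simp
  also have "\<dots> = (\<Sum>v\<in>V. \<Sum>w\<in>V. if w \<in> ?N v then ?q v / real (card (?N v)) * f w else 0)"
    by (rule sum.swap)
  also have "\<dots> = (\<Sum>v\<in>V. ?q v * ((\<Sum>w\<in>?N v. f w) / real (card (?N v))))"
  proof (intro sum.cong refl)
    fix v assume "v \<in> V"
    then have "V \<inter> ?N v = ?N v" using neighbours_subset by blast
    then show "(\<Sum>w\<in>V. if w \<in> ?N v then ?q v / real (card (?N v)) * f w else 0) =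
        ?q v * ((\<Sum>w\<in>?N v. f w) / real (card (?N v)))"
      using finite_V by (simp add: sum.inter_restrict[symmetric] sum_distrib_left sum_divide_distrib)
  qed
  finally show ?thesis .
qed

text \<open>The measure assigning mass \<open>c \<cdot> deg v\<close> to \<open>v\<close> is invariant under the walk.\<close>

lemma prob_position_le:
  assumes c: "1 / real (card V) \<le> c"
    and "w \<in> V"
  shows "\<P>(\<omega> in M. Y t \<omega> = w) \<le> c * real (card (neighbours E w))"
  using \<open>w \<in> V\<close>
proof (induction t arbitrary: w)
  case 0
  have "0 \<le> c" by (rule order_trans[OF _ c]) simp
  moreover have "1 \<le> real (card (neighbours E w))" using card_neighbours_pos[OF 0] by linarith
  ultimately have "c * 1 \<le> c * real (card (neighbours E w))" by (rule mult_left_mono[rotated])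
  with c show ?case using 0 uniform_start by simp
next
  case (Suc t)
  have sym: "w \<in> neighbours E v \<longleftrightarrow> v \<in> neighbours E w" for v
    by (simp add: neighbours_def insert_commute)
  have "\<P>(\<omega> in M. Y (Suc t) \<omega> = w) = (\<Sum>v\<in>V. if w \<in> neighbours E v
      then \<P>(\<omega> in M. Y t \<omega> = v) / real (card (neighbours E v)) else 0)"
    using prob_step[of t "\<lambda>_. True" w] by (simp add: determined_by_past_def cong: if_cong)
  \<comment> \<open>By induction each \<open>v\<close> adjacent to \<open>w\<close> holds mass at
    most \<open>c * deg v\<close> and sends the fraction \<open>1 / deg v\<close> of it to
    \<open>w\<close>, hence at most \<open>c\<close>.\<close>
  also have "\<dots> \<le> (\<Sum>v\<in>V. if v \<in> neighbours E w then c else 0)"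
    using Suc.IH card_neighbours_pos
    by (intro sum_mono) (auto simp: sym divide_le_eq)
  also have "\<dots> = c * real (card (V \<inter> neighbours E w))"
    using finite_V by (simp add: sum.inter_restrict[symmetric])
  also have "V \<inter> neighbours E w = neighbours E w"
    using neighbours_subset[OF Suc.prems] by blast
  finally show ?case .
qed

end

section \<open>Capture time and its tail sum\<close>

lemma less_capture_time_iff:
  "enat s < capture_time x y \<longleftrightarrow> (\<forall>t\<le>s. \<not> captured_in_round x y t)"
proof
  assume less: "enat s < capture_time x y"
  show "\<forall>t\<le>s. \<not> captured_in_round x y t"
  proof (intro allI impI notI)
    fix t assume "t \<le> s" "captured_in_round x y t"
    then have "capture_time x y \<le> enat t" unfolding capture_time_def by (intro Inf_lower) auto
    also have "\<dots> \<le> enat s" using \<open>t \<le> s\<close> by simp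
    finally show False using less by simp
  qed
next
  assume "\<forall>t\<le>s. \<not> captured_in_round x y t"
  then have "enat (Suc s) \<le> capture_time x y"
    unfolding capture_time_def by (intro Inf_greatest) (auto simp: not_less_eq_eq[symmetric])
  then show "enat s < capture_time x y" by (rule less_le_trans[rotated]) simp
qed

text \<open>Pointwise form of the tail-sum formula for expectations; the bound \<open>N\<close>
  keeps the sum finite.\<close>

lemma ennreal_of_enat_eq_sum:
  assumes "e \<le> enat N"
  shows "ennreal_of_enat e = (\<Sum>s<N. if enat s < e then 1 else 0)"
proof -
  obtain k where k: "e = enat k" "k \<le> N" using assms by (cases e) auto
  have "{..<N} \<inter> {s. s < k} = {..<k}" using k(2) by auto
  then show ?thesis using k by (simp add: sum.If_cases)
qed

section \<open>Neighbourhoods in the path\<close>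

lemma mem_neighbours_path_iff:
  "w \<in> neighbours (path_edges n) v \<longleftrightarrow> (v = Suc w \<and> v < n) \<or> (w = Suc v \<and> w < n)"
proof -
  have "w \<in> neighbours (path_edges n) v \<longleftrightarrow>
      (\<exists>i. {v, w} = {i - 1, i} \<and> 1 \<le> i \<and> i \<le> n - 1)"
    by (simp add: neighbours_def path_edges_def)
  also have "\<dots> \<longleftrightarrow> (v = Suc w \<and> v < n) \<or> (w = Suc v \<and> w < n)"
    \<comment> \<open>The witness \<open>i\<close> is the larger endpoint of the edge.\<close>
    by (auto simp: doubleton_eq_iff intro: exI[of _ v] exI[of _ w])
  finally show ?thesis .
qed

lemma card_neighbours_path_last: "n \<ge> 2 \<Longrightarrow> card (neighbours (path_edges n) (n - 1)) = 1"
proof -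
  assume "n \<ge> 2"
  then have "neighbours (path_edges n) (n - 1) = {n - 2}"
    by (auto simp: mem_neighbours_path_iff)
  then show ?thesis by simp
qed

text \<open>Steps are fair at inner vertices and forced backwards at \<open>n - 1\<close>. Vertex 0,
  where the walk is pushed forwards, is excluded: the cop starts there, so a free robber is never on
  it.\<close>

lemma average_over_neighbours_path:
  fixes c :: real
  assumes "0 < v" "v < n"
  shows "(\<Sum>w\<in>neighbours (path_edges n) v. real w - c) / real (card (neighbours (path_edges n) v)) =
    real v - c - (if v = n - 1 then 1 else 0)"
proof (cases "v = n - 1")
  case True
  with assms have "neighbours (path_edges n) v = {v - 1}"
    by (auto simp: mem_neighbours_path_iff)
  with True assms show ?thesis by (simp add: of_nat_diff)
next
  case False
  with assms have "neighbours (path_edges n) v = {v - 1, v + 1}"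
    by (auto simp: mem_neighbours_path_iff)
  with False assms show ?thesis by (simp add: of_nat_diff)
qed

section \<open>The sweeping cop on a path with at least two vertices\<close>

locale path_drunk_robber = drunk_robber M "path_vertices n" "path_edges n" Y
  for M :: "'a measure" and n :: nat and Y :: "nat \<Rightarrow> 'a \<Rightarrow> nat" +
  assumes n_ge_2: "n \<ge> 2"
begin

sublocale finite_drunk_robber M "path_vertices n" "path_edges n" Y
proof
  fix v assume v: "v \<in> path_vertices n"
  show "neighbours (path_edges n) v \<subseteq> path_vertices n"
    using v by (auto simp: mem_neighbours_path_iff path_vertices_def)
  have "(if v = 0 then 1 else v - 1) \<in> neighbours (path_edges n) v"
    using v n_ge_2 by (auto simp: mem_neighbours_path_iff path_vertices_def)
  then show "neighbours (path_edges n) v \<noteq> {}" by blast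
qed (simp add: path_vertices_def)

definition uncaptured :: "nat \<Rightarrow> (nat \<Rightarrow> nat) \<Rightarrow> bool" where
  "uncaptured s y \<longleftrightarrow> (\<forall>t\<le>s. \<not> captured_in_round (sweeping_cop n) y t)"

text \<open>The distribution of the walk killed at capture, of total mass P(T > s).\<close>

definition free_prob :: "nat \<Rightarrow> nat \<Rightarrow> real" where
  "free_prob s v = \<P>(\<omega> in M. uncaptured s (\<lambda>t. Y t \<omega>) \<and> Y s \<omega> = v)"

lemma uncaptured_0: "uncaptured 0 y \<longleftrightarrow> y 0 \<noteq> 0"
  by (auto simp: uncaptured_def captured_in_round_def sweeping_cop_def)

lemma uncaptured_Suc:
  "Suc s < n \<Longrightarrow> uncaptured (Suc s) y \<longleftrightarrow> uncaptured s y \<and> y s \<noteq> Suc s \<and> y (Suc s) \<noteq> Suc s"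
  by (auto simp: uncaptured_def captured_in_round_def sweeping_cop_def le_Suc_eq)

lemma determined_by_past_uncaptured: "determined_by_past s (uncaptured s)"
  unfolding determined_by_past_def uncaptured_def captured_in_round_def by (metis Suc_leD)

lemma uncaptured_event: "{\<omega> \<in> space M. uncaptured s (\<lambda>t. Y t \<omega>)} \<in> events"
  by (rule history_event[OF determined_by_past_uncaptured])

lemma free_prob_nonneg: "0 \<le> free_prob s v"
  by (simp add: free_prob_def)

text \<open>The state halfway through round \<open>Suc s\<close>. The cop's move is judged against
  the robber's position at time \<open>s\<close>, so this is still an event of the past when the
  robber steps.\<close>

definition survives_cop_move :: "nat \<Rightarrow> (nat \<Rightarrow> nat) \<Rightarrow> bool" where
  "survives_cop_move s y \<longleftrightarrow> uncaptured s y \<and> y s \<noteq> Suc s"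

lemma determined_by_past_survives: "determined_by_past s (survives_cop_move s)"
  using determined_by_past_conj[OF determined_by_past_uncaptured
      determined_by_past_coordinate[of s s "\<lambda>x. x \<noteq> Suc s"]]
  by (simp add: survives_cop_move_def[abs_def])

lemma prob_survives:
  "\<P>(\<omega> in M. survives_cop_move s (\<lambda>t. Y t \<omega>) \<and> Y s \<omega> = v) =
    (if v = Suc s then 0 else free_prob s v)"
proof (cases "v = Suc s")
  case True
  then have "{\<omega> \<in> space M. survives_cop_move s (\<lambda>t. Y t \<omega>) \<and> Y s \<omega> = v} = {}"
    by (auto simp: survives_cop_move_def)
  with True show ?thesis by (simp only: measure_empty) simp
next
  case False
  then show ?thesis unfolding free_prob_def
    by (auto simp: survives_cop_move_def intro!: arg_cong[where f = prob])
qed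

text \<open>After the cop's move, only stepping onto the cop's vertex \<open>Suc s\<close> can lead
  to capture in this round; elsewhere no mass is lost.\<close>

lemma free_prob_Suc:
  assumes "Suc s < n" "w \<noteq> Suc s"
  shows "free_prob (Suc s) w = \<P>(\<omega> in M. survives_cop_move s (\<lambda>t. Y t \<omega>) \<and> Y (Suc s) \<omega> = w)"
  unfolding free_prob_def using assms
  by (auto simp: survives_cop_move_def uncaptured_Suc intro!: arg_cong[where f = prob])

lemma free_prob_at_cop: "s < n \<Longrightarrow> free_prob s s = 0"
proof -
  assume "s < n"
  then have "{\<omega> \<in> space M. uncaptured s (\<lambda>t. Y t \<omega>) \<and> Y s \<omega> = s} = {}"
    by (auto simp: uncaptured_def captured_in_round_def sweeping_cop_def)
  then show ?thesis unfolding free_prob_def by (simp only: measure_empty)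
qed

text \<open>The robber cannot slip past: a step to a vertex below \<open>Suc s\<close> starts at
  \<open>Suc s\<close>, where the cop's move has just caught him, or at some
  \<open>u \<le> s\<close>, which the induction hypothesis rules out.\<close>

lemma free_prob_behind_cop: "s < n \<Longrightarrow> v \<le> s \<Longrightarrow> free_prob s v = 0"
proof (induction s arbitrary: v)
  case 0
  then show ?case using free_prob_at_cop[of 0] by simp
next
  case (Suc s)
  show ?case
  proof (cases "v = Suc s")
    case True
    with Suc.prems show ?thesis using free_prob_at_cop by simp
  next
    case False
    have "u = Suc s \<or> free_prob s u = 0" if "v \<in> neighbours (path_edges n) u" for u
    proof -
      have "u \<le> Suc s" using that Suc.prems False by (auto simp: mem_neighbours_path_iff)
      then show ?thesis using Suc.IH[of u] Suc.prems by (cases "u = Suc s") auto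
    qed
    then show ?thesis
      unfolding free_prob_Suc[OF Suc.prems(1) False] prob_step[OF determined_by_past_survives] prob_survives
      by (intro sum.neutral) auto
  qed
qed

section \<open>Drift of the mean gap\<close>

text \<open>The mean of \<open>Y s - s\<close> on the event T > s. By
  \<open>free_prob_behind_cop\<close>, no negative term has weight while
  \<open>s < n\<close>.\<close>

definition mean_gap :: "nat \<Rightarrow> real" where
  "mean_gap s = (\<Sum>v<n. free_prob s v * (real v - real s))"

lemma sum_free_prob: "(\<Sum>v<n. free_prob s v) = \<P>(\<omega> in M. uncaptured s (\<lambda>t. Y t \<omega>))"
  unfolding free_prob_def
  by (rule prob_sum[symmetric]) (use Y_in_V in
    \<open>auto intro!: sets.sets_Collect_conj uncaptured_event position_event simp: path_vertices_def\<close>)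

lemma free_prob_le_position: "free_prob s v \<le> \<P>(\<omega> in M. Y s \<omega> = v)"
  unfolding free_prob_def by (intro finite_measure_mono position_event) auto

text \<open>The end vertex has degree 1, so its mass is at most the constant \<open>c\<close>
  itself. The choice \<open>1 / (real n - 1)\<close> makes the bounds over \<open>n - 1\<close>
  rounds add up to exactly 1.\<close>

lemma prob_last_le: "\<P>(\<omega> in M. Y s \<omega> = n - 1) \<le> 1 / (real n - 1)"
proof -
  have "1 / real (card (path_vertices n)) \<le> 1 / (real n - 1)"
    using n_ge_2 by (simp add: path_vertices_def frac_le)
  from prob_position_le[OF this, of "n - 1" s] show ?thesis
    using n_ge_2 card_neighbours_path_last[OF n_ge_2] by (simp add: path_vertices_def)
qed

text \<open>A robber adjacent to the cop is captured by the cop's own move, which closes the gap by exactly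
  one; this is why no step back is counted for \<open>Suc s = n - 1\<close>.\<close>

lemma mean_gap_Suc:
  assumes "Suc s < n"
  shows "mean_gap (Suc s) =
    mean_gap s - (\<Sum>v<n. free_prob s v) - (if Suc s = n - 1 then 0 else free_prob s (n - 1))"
proof -
  let ?q = "\<lambda>v. \<P>(\<omega> in M. survives_cop_move s (\<lambda>t. Y t \<omega>) \<and> Y s \<omega> = v)"
  have V: "path_vertices n = {..<n}" by (auto simp: path_vertices_def)
  \<comment> \<open>Capture by the robber's own step happens at gap zero, so ignoring it does not
    change the weighted sum.\<close>
  have cop: "free_prob (Suc s) w * (real w - real (Suc s)) =
      \<P>(\<omega> in M. survives_cop_move s (\<lambda>t. Y t \<omega>) \<and> Y (Suc s) \<omega> = w) * (real w - real (Suc s))" for w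
    using free_prob_Suc[OF assms, of w] by (cases "w = Suc s") simp_all
  have "mean_gap (Suc s) = (\<Sum>w<n.
      \<P>(\<omega> in M. survives_cop_move s (\<lambda>t. Y t \<omega>) \<and> Y (Suc s) \<omega> = w) * (real w - real (Suc s)))"
    unfolding mean_gap_def by (intro sum.cong refl cop)
  also have "\<dots> = (\<Sum>v<n. ?q v * ((\<Sum>w\<in>neighbours (path_edges n) v. real w - real (Suc s)) /
      real (card (neighbours (path_edges n) v))))"
    using expectation_step[OF determined_by_past_survives] by (simp only: V)
  also have "\<dots> = (\<Sum>v<n. free_prob s v * (real v - real s) - free_prob s v -
      (if v = n - 1 then (if Suc s = n - 1 then 0 else free_prob s (n - 1)) else 0))"
  proof (intro sum.cong refl)
    fix v assume "v \<in> {..<n}"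
    then have v: "v < n" by simp
    show "?q v * ((\<Sum>w\<in>neighbours (path_edges n) v. real w - real (Suc s)) /
        real (card (neighbours (path_edges n) v))) =
      free_prob s v * (real v - real s) - free_prob s v -
      (if v = n - 1 then (if Suc s = n - 1 then 0 else free_prob s (n - 1)) else 0)"
    proof (cases "v \<le> s")
      case True
      then have "free_prob s v = 0" using free_prob_behind_cop assms by simp
      with True assms show ?thesis by (auto simp: prob_survives)
    next
      \<comment> \<open>For \<open>v = Suc s\<close> the left side is zero by the cop's capture, and
        the right side cancels because the gap is 1. For larger \<open>v\<close> the neighbour
        average applies, and \<open>v = n - 1\<close> then forces
        \<open>Suc s \<noteq> n - 1\<close>.\<close>
      case False
      then show ?thesis using v
        by (simp add: average_over_neighbours_path prob_survives algebra_simps)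
    qed
  qed
  also have "\<dots> = mean_gap s - (\<Sum>v<n. free_prob s v) -
      (if Suc s = n - 1 then 0 else free_prob s (n - 1))"
    using n_ge_2 by (simp add: sum_subtractf mean_gap_def)
  finally show ?thesis .
qed

lemma mean_gap_0: "mean_gap 0 = (real n - 1) / 2"
proof -
  have "free_prob 0 v * real v = real v / real n" if "v < n" for v
  proof (cases "v = 0")
    case False
    then have "free_prob 0 v = \<P>(\<omega> in M. Y 0 \<omega> = v)"
      unfolding free_prob_def uncaptured_0 by (intro arg_cong[where f = prob]) auto
    then show ?thesis using uniform_start that by (simp add: path_vertices_def)
  qed simp
  then have "mean_gap 0 = (\<Sum>v<n. real v) / real n"
    by (simp add: mean_gap_def sum_divide_distrib)
  \<comment> \<open>Stated for arbitrary \<open>m\<close>, since \<open>n\<close> is fixed by the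
    locale and does not allow induction.\<close>
  also have "(\<Sum>v<m. real v) = real m * (real m - 1) / 2" for m
    by (induction m) (auto simp: field_simps)
  finally show ?thesis using n_ge_2 by simp
qed

text \<open>Once the cop stands at \<open>n - 1\<close>, no vertex lies ahead of him, so capture is
  almost sure by then.\<close>

lemma free_prob_final: "v < n \<Longrightarrow> free_prob (n - 1) v = 0"
  using n_ge_2 by (intro free_prob_behind_cop) auto

text \<open>Telescope \<open>mean_gap_Suc\<close> from the initial mean gap down to the final gap 0;
  the survival probabilities and the steps back share the total decrease.\<close>

lemma sum_uncaptured:
  "(\<Sum>s<n - 1. \<P>(\<omega> in M. uncaptured s (\<lambda>t. Y t \<omega>))) =
    (real n - 1) / 2 - (\<Sum>s<n - 1. if Suc s = n - 1 then 0 else free_prob s (n - 1))"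
proof -
  have "mean_gap 0 - mean_gap (n - 1) = (\<Sum>s<n - 1. mean_gap s - mean_gap (Suc s))"
    by (rule sum_lessThan_telescope'[symmetric])
  also have "\<dots> = (\<Sum>s<n - 1. \<P>(\<omega> in M. uncaptured s (\<lambda>t. Y t \<omega>)) +
      (if Suc s = n - 1 then 0 else free_prob s (n - 1)))"
    by (intro sum.cong refl) (simp add: mean_gap_Suc sum_free_prob[symmetric])
  also have "mean_gap (n - 1) = 0"
    unfolding mean_gap_def by (intro sum.neutral) (simp add: free_prob_final del: One_nat_def)
  finally show ?thesis unfolding mean_gap_0 sum.distrib by linarith
qed

section \<open>Bounds on the expected capture time\<close>

text \<open>The tail-sum formula, cut off at \<open>n - 1\<close>. The cut-off holds only almost
  surely, because the step law does not exclude jumps over the cop on a null set.\<close>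

lemma expected_capture_time_eq:
  "expected_capture_time M (sweeping_cop n) Y =
    ennreal (\<Sum>s<n - 1. \<P>(\<omega> in M. uncaptured s (\<lambda>t. Y t \<omega>)))"
proof -
  let ?U = "\<lambda>s. {\<omega> \<in> space M. uncaptured s (\<lambda>t. Y t \<omega>)}"
  let ?T = "\<lambda>\<omega>. capture_time (sweeping_cop n) (\<lambda>t. Y t \<omega>)"
  have T: "enat s < ?T \<omega> \<longleftrightarrow> uncaptured s (\<lambda>t. Y t \<omega>)" for s \<omega>
    unfolding uncaptured_def by (rule less_capture_time_iff)
  have "prob (?U (n - 1)) = 0"
    unfolding sum_free_prob[symmetric] by (intro sum.neutral) (simp add: free_prob_final del: One_nat_def)
  then have "?U (n - 1) \<in> null_sets M"
    using uncaptured_event by (simp add: null_sets_def emeasure_eq_measure)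
  then have "AE \<omega> in M. \<not> uncaptured (n - 1) (\<lambda>t. Y t \<omega>)"
    by (rule AE_I') auto
  then have "AE \<omega> in M. ennreal_of_enat (?T \<omega>) = (\<Sum>s<n - 1. indicator (?U s) \<omega>)"
  proof (rule AE_mp, intro AE_I2 impI)
    fix \<omega> assume "\<omega> \<in> space M" "\<not> uncaptured (n - 1) (\<lambda>t. Y t \<omega>)"
    then have T_le: "?T \<omega> \<le> enat (n - 1)" using T[of "n - 1" \<omega>] by simp
    show "ennreal_of_enat (?T \<omega>) = (\<Sum>s<n - 1. indicator (?U s) \<omega>)"
      unfolding ennreal_of_enat_eq_sum[OF T_le] using \<open>\<omega> \<in> space M\<close>
      by (intro sum.cong refl) (simp add: T)
  qed
  then have "expected_capture_time M (sweeping_cop n) Y =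
      (\<integral>\<^sup>+\<omega>. (\<Sum>s<n - 1. indicator (?U s) \<omega>) \<partial>M)"
    unfolding expected_capture_time_def by (rule nn_integral_cong_AE)
  also have "\<dots> = (\<Sum>s<n - 1. emeasure M (?U s))"
    using uncaptured_event by (simp add: nn_integral_sum)
  also have "\<dots> = ennreal (\<Sum>s<n - 1. prob (?U s))"
    by (simp add: emeasure_eq_measure sum_ennreal)
  finally show ?thesis .
qed

text \<open>The loss from steps back lies between 0 and 1, and
  \<open>(n - 1) / 2 - 1 = n / 2 * (1 - 3 / n)\<close> produces the constant 3.\<close>

lemma expected_capture_time_bounds:
  "ennreal (real n / 2 * (1 - 3 / real n)) \<le> expected_capture_time M (sweeping_cop n) Y"
  "expected_capture_time M (sweeping_cop n) Y \<le> ennreal ((real n - 1) / 2)"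
proof -
  let ?loss = "\<Sum>s<n - 1. if Suc s = n - 1 then 0 else free_prob s (n - 1)"
  have "0 \<le> ?loss" by (intro sum_nonneg) (simp add: free_prob_nonneg)
  then show "expected_capture_time M (sweeping_cop n) Y \<le> ennreal ((real n - 1) / 2)"
    unfolding expected_capture_time_eq sum_uncaptured by (intro ennreal_leI) linarith
  have "?loss \<le> (\<Sum>s<n - 1. 1 / (real n - 1))"
    using n_ge_2 order_trans[OF free_prob_le_position prob_last_le] by (intro sum_mono) auto
  also have "\<dots> = 1" using n_ge_2 by (simp add: of_nat_diff)
  finally show "ennreal (real n / 2 * (1 - 3 / real n)) \<le> expected_capture_time M (sweeping_cop n) Y"
    unfolding expected_capture_time_eq sum_uncaptured using n_ge_2
    by (intro ennreal_leI) (simp add: field_simps)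
qed

end

lemma expected_capture_time_single_vertex:
  assumes "drunk_robber M (path_vertices 1) (path_edges 1) Y"
  shows "expected_capture_time M (sweeping_cop 1) Y = 0"
proof -
  interpret drunk_robber M "path_vertices 1" "path_edges 1" Y by (rule assms)
  have "capture_time (sweeping_cop 1) (\<lambda>t. Y t \<omega>) = 0" if "\<omega> \<in> space M" for \<omega>
  proof -
    have "Y 0 \<omega> = 0"
      using measurable_space[OF random_position that, of 0] by (simp add: path_vertices_def)
    then have "captured_in_round (sweeping_cop 1) (\<lambda>t. Y t \<omega>) 0"
      by (simp add: captured_in_round_def sweeping_cop_def)
    then have "\<not> enat 0 < capture_time (sweeping_cop 1) (\<lambda>t. Y t \<omega>)"
      unfolding less_capture_time_iff by blast
    then show ?thesis by (simp add: zero_enat_def[symmetric])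
  qed
  then have "expected_capture_time M (sweeping_cop 1) Y = (\<integral>\<^sup>+\<omega>. 0 \<partial>M)"
    unfolding expected_capture_time_def by (intro nn_integral_cong) simp
  then show ?thesis by simp
qed

theorem theorem3p1:
  "\<exists>g \<in> O(\<lambda>n::nat. ln (real n) / real n). \<forall>n\<ge>1. \<forall>(M :: 'a measure) (Y :: nat \<Rightarrow> 'a \<Rightarrow> nat).
     drunk_robber M (path_vertices n) (path_edges n) Y \<longrightarrow>
       ennreal (real n / 2 * (1 - g n)) \<le> expected_capture_time M (sweeping_cop n) Y \<and>
       expected_capture_time M (sweeping_cop n) Y \<le> ennreal ((real n - 1) / 2)"
proof (rule bexI[of _ "\<lambda>n. 3 / real n"], intro allI impI)
  show "(\<lambda>n. 3 / real n) \<in> O(\<lambda>n. ln (real n) / real n)" by real_asymp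
next
  fix n :: nat and M :: "'a measure" and Y :: "nat \<Rightarrow> 'a \<Rightarrow> nat"
  assume "1 \<le> n" and robber: "drunk_robber M (path_vertices n) (path_edges n) Y"
  show "ennreal (real n / 2 * (1 - 3 / real n)) \<le> expected_capture_time M (sweeping_cop n) Y \<and>
      expected_capture_time M (sweeping_cop n) Y \<le> ennreal ((real n - 1) / 2)"
  proof (cases "n = 1")
    case True
    \<comment> \<open>Here the lower bound is -1, which \<open>ennreal\<close> sends to 0, and the
      upper bound is 0.\<close>
    with robber expected_capture_time_single_vertex[of M Y] show ?thesis by (simp add: ennreal_neg)
  next
    case False
    with robber \<open>1 \<le> n\<close> interpret path_drunk_robber M n Y
      by (intro path_drunk_robber.intro path_drunk_robber_axioms.intro) auto
    show ?thesis using expected_capture_time_bounds by blast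
  qed
qed

end
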